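(* Let $A$ and $B$ be bounded lattices with $|A|>2$ and $|B|>2$, and let $A\boxplus B$ be their horizontal sum. Then ${\rm Spec}_{\rm Filt}(A\boxplus B)\subseteq\{A\setminus\{0\},B\setminus\{0\}\}$, ${\rm Spec}_{\rm Id}(A\boxplus B)\subseteq\{A\setminus\{1\},B\setminus\{1\}\}$, and the following are equivalent: (i) $0$ is meet-irreducible in $A$ and $1$ is join-irreducible in $B$; (ii) $A\setminus\{0\}\in{\rm Spec}_{\rm Filt}(A\boxplus B)$; (iii) $B\setminus\{1\}\in{\rm Spec}_{\rm Id}(A\boxplus B)$; (iv) $eq(A\setminus\{0\},B\setminus\{1\})\in{\rm Con}(A\boxplus B)$; (v) $eq(A\setminus\{0\},B\setminus\{1\})\in{\rm Max}(A\boxplus B)$.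
   Context: Horizontal sum: for non-trivial bounded lattices $A$ and $B$ (at least two elements each), $A\boxplus B$ is the bounded lattice obtained from the disjoint union of $A$ and $B$ by identifying $0^A=0^B=:0$ and $1^A=1^B=:1$; $A$ and $B$ are regarded as subsets of $A\boxplus B$ with $A\cap B=\{0,1\}$, and the order is the union of the orders of $A$ and $B$ (so $a\vee b=1$ and $a\wedge b=0$ for $a\in A\setminus\{0,1\}$, $b\in B\setminus\{0,1\}$). For a lattice $L$: ${\rm Con}(L)$ is the lattice of congruences of $L$, ${\rm Max}(L)$ is the set of maximal (proper) congruences of $L$, and ${\rm Spec}_{\rm Filt}(L)$, ${\rm Spec}_{\rm Id}(L)$ are the sets of (proper) prime filters and (proper) prime ideals of $L$. For a partition $\{M_1,\dots,M_n\}$ of a set $M$, $eq(M_1,\dots,M_n)$ is the equivalence relation on $M$ whose classes are $M_1,\dots,M_n$. In a bounded lattice, $0$ is meet-irreducible if $x\wedge y=0$ implies $x=0$ or $y=0$; $1$ is join-irreducible if $x\vee y=1$ implies $x=1$ or $y=1$. *)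

theory Defs
  imports "HOL-Algebra.Lattice"
begin

section \<open>Filters, ideals and congruences of a lattice\<close>

definition lattice_filter :: "('a, 'm) gorder_scheme \<Rightarrow> 'a set \<Rightarrow> bool" where
  "lattice_filter L F \<longleftrightarrow> F \<subseteq> carrier L \<and> F \<noteq> {} \<and>
     (\<forall>x\<in>F. \<forall>y\<in>F. x \<sqinter>\<^bsub>L\<^esub> y \<in> F) \<and>
     (\<forall>x\<in>F. \<forall>y\<in>carrier L. x \<sqsubseteq>\<^bsub>L\<^esub> y \<longrightarrow> y \<in> F)"

definition lattice_ideal :: "('a, 'm) gorder_scheme \<Rightarrow> 'a set \<Rightarrow> bool" where
  "lattice_ideal L I \<longleftrightarrow> I \<subseteq> carrier L \<and> I \<noteq> {} \<and>
     (\<forall>x\<in>I. \<forall>y\<in>I. x \<squnion>\<^bsub>L\<^esub> y \<in> I) \<and>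
     (\<forall>x\<in>I. \<forall>y\<in>carrier L. y \<sqsubseteq>\<^bsub>L\<^esub> x \<longrightarrow> y \<in> I)"

definition Spec_Filt :: "('a, 'm) gorder_scheme \<Rightarrow> 'a set set" where
  "Spec_Filt L = {F. lattice_filter L F \<and> F \<noteq> carrier L \<and>
     (\<forall>x\<in>carrier L. \<forall>y\<in>carrier L. x \<squnion>\<^bsub>L\<^esub> y \<in> F \<longrightarrow> x \<in> F \<or> y \<in> F)}"

definition Spec_Id :: "('a, 'm) gorder_scheme \<Rightarrow> 'a set set" where
  "Spec_Id L = {I. lattice_ideal L I \<and> I \<noteq> carrier L \<and>
     (\<forall>x\<in>carrier L. \<forall>y\<in>carrier L. x \<sqinter>\<^bsub>L\<^esub> y \<in> I \<longrightarrow> x \<in> I \<or> y \<in> I)}"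

definition Con :: "('a, 'm) gorder_scheme \<Rightarrow> 'a rel set" where
  "Con L = {\<theta>. equiv (carrier L) \<theta> \<and>
     (\<forall>(x, x')\<in>\<theta>. \<forall>(y, y')\<in>\<theta>.
        (x \<squnion>\<^bsub>L\<^esub> y, x' \<squnion>\<^bsub>L\<^esub> y') \<in> \<theta> \<and> (x \<sqinter>\<^bsub>L\<^esub> y, x' \<sqinter>\<^bsub>L\<^esub> y') \<in> \<theta>)}"

definition Max_Con :: "('a, 'm) gorder_scheme \<Rightarrow> 'a rel set" where
  "Max_Con L = {\<theta> \<in> Con L. \<theta> \<noteq> carrier L \<times> carrier L \<and>
     (\<forall>\<psi>\<in>Con L. \<theta> \<subset> \<psi> \<longrightarrow> \<psi> = carrier L \<times> carrier L)}"

text \<open>The equivalence relation whose classes are the members of a partition.\<close>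

definition eq_of :: "'a set set \<Rightarrow> 'a rel" where
  "eq_of P = {(x, y). \<exists>M\<in>P. x \<in> M \<and> y \<in> M}"

definition bottom_meet_irreducible :: "('a, 'm) gorder_scheme \<Rightarrow> bool" where
  "bottom_meet_irreducible L \<longleftrightarrow>
     (\<forall>x\<in>carrier L. \<forall>y\<in>carrier L. x \<sqinter>\<^bsub>L\<^esub> y = \<bottom>\<^bsub>L\<^esub> \<longrightarrow> x = \<bottom>\<^bsub>L\<^esub> \<or> y = \<bottom>\<^bsub>L\<^esub>)"

definition top_join_irreducible :: "('a, 'm) gorder_scheme \<Rightarrow> bool" where
  "top_join_irreducible L \<longleftrightarrow>
     (\<forall>x\<in>carrier L. \<forall>y\<in>carrier L. x \<squnion>\<^bsub>L\<^esub> y = \<top>\<^bsub>L\<^esub> \<longrightarrow> x = \<top>\<^bsub>L\<^esub> \<or> y = \<top>\<^bsub>L\<^esub>)"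


section \<open>Horizontal sum\<close>

text \<open>
  The horizontal sum is the quotient of the disjoint union of the two carriers by the relation
  that identifies the two bottoms and the two tops. This relation is an equivalence when
  both lattices are non-trivial. The maps \<open>hsum_inl A B\<close> and \<open>hsum_inr A B\<close> are the
  canonical embeddings, through which \<open>A\<close> and \<open>B\<close> are regarded as subsets of the sum.
\<close>

definition hsum_glue :: "('a, 'm) gorder_scheme \<Rightarrow> ('b, 'n) gorder_scheme \<Rightarrow> ('a + 'b) rel" where
  "hsum_glue A B = Id_on (carrier A <+> carrier B) \<union>
     {(Inl \<bottom>\<^bsub>A\<^esub>, Inr \<bottom>\<^bsub>B\<^esub>), (Inr \<bottom>\<^bsub>B\<^esub>, Inl \<bottom>\<^bsub>A\<^esub>),
      (Inl \<top>\<^bsub>A\<^esub>, Inr \<top>\<^bsub>B\<^esub>), (Inr \<top>\<^bsub>B\<^esub>, Inl \<top>\<^bsub>A\<^esub>)}"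

definition hsum_inl :: "('a, 'm) gorder_scheme \<Rightarrow> ('b, 'n) gorder_scheme \<Rightarrow> 'a \<Rightarrow> ('a + 'b) set" where
  "hsum_inl A B a = hsum_glue A B `` {Inl a}"

definition hsum_inr :: "('a, 'm) gorder_scheme \<Rightarrow> ('b, 'n) gorder_scheme \<Rightarrow> 'b \<Rightarrow> ('a + 'b) set" where
  "hsum_inr A B b = hsum_glue A B `` {Inr b}"

definition hsum :: "('a, 'm) gorder_scheme \<Rightarrow> ('b, 'n) gorder_scheme \<Rightarrow> ('a + 'b) set gorder"
    (infixl \<open>\<boxplus>\<close> 65) where
  "A \<boxplus> B =
     \<lparr> carrier = (carrier A <+> carrier B) // hsum_glue A B,
       eq = (=),
       le = (\<lambda>X Y.
         (\<exists>a\<in>carrier A. \<exists>a'\<in>carrier A. X = hsum_inl A B a \<and> Y = hsum_inl A B a' \<and> a \<sqsubseteq>\<^bsub>A\<^esub> a') \<or>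
         (\<exists>b\<in>carrier B. \<exists>b'\<in>carrier B. X = hsum_inr A B b \<and> Y = hsum_inr A B b' \<and> b \<sqsubseteq>\<^bsub>B\<^esub> b')) \<rparr>"

locale hsum_summands =
  A: bounded_lattice A + B: bounded_lattice B
  for A :: "('a, 'm) gorder_scheme" (structure) and B :: "('b, 'n) gorder_scheme" (structure) +
  assumes A_nontrivial: "\<bottom>\<^bsub>A\<^esub> \<noteq> \<top>\<^bsub>A\<^esub>" and B_nontrivial: "\<bottom>\<^bsub>B\<^esub> \<noteq> \<top>\<^bsub>B\<^esub>"
begin

abbreviation "f \<equiv> hsum_inl A B"
abbreviation "g \<equiv> hsum_inr A B"
abbreviation "H \<equiv> A \<boxplus> B"

lemma bounds_closed [simp]:
  "\<bottom>\<^bsub>A\<^esub> \<in> carrier A" "\<top>\<^bsub>A\<^esub> \<in> carrier A" "\<bottom>\<^bsub>B\<^esub> \<in> carrier B" "\<top>\<^bsub>B\<^esub> \<in> carrier B"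
  by (simp_all add: A.bottom_closed A.top_closed B.bottom_closed B.top_closed)

lemma equiv_hsum_glue: "equiv (carrier A <+> carrier B) (hsum_glue A B)"
  using A_nontrivial B_nontrivial
  by (auto intro!: equivI simp: hsum_glue_def refl_on_def sym_def trans_def)

lemma inl_eq_iff:
  "\<lbrakk>a \<in> carrier A; a' \<in> carrier A\<rbrakk> \<Longrightarrow> f a = f a' \<longleftrightarrow> a = a'"
  unfolding hsum_inl_def by (subst eq_equiv_class_iff[OF equiv_hsum_glue]) (auto simp: hsum_glue_def)

lemma inr_eq_iff:
  "\<lbrakk>b \<in> carrier B; b' \<in> carrier B\<rbrakk> \<Longrightarrow> g b = g b' \<longleftrightarrow> b = b'"
  unfolding hsum_inr_def by (subst eq_equiv_class_iff[OF equiv_hsum_glue]) (auto simp: hsum_glue_def)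

lemma inl_eq_inr_iff:
  "\<lbrakk>a \<in> carrier A; b \<in> carrier B\<rbrakk> \<Longrightarrow>
    f a = g b \<longleftrightarrow> a = \<bottom>\<^bsub>A\<^esub> \<and> b = \<bottom>\<^bsub>B\<^esub> \<or> a = \<top>\<^bsub>A\<^esub> \<and> b = \<top>\<^bsub>B\<^esub>"
  unfolding hsum_inl_def hsum_inr_def
  by (subst eq_equiv_class_iff[OF equiv_hsum_glue]) (auto simp: hsum_glue_def)

lemma inr_eq_inl_iff:
  "\<lbrakk>a \<in> carrier A; b \<in> carrier B\<rbrakk> \<Longrightarrow>
    g b = f a \<longleftrightarrow> a = \<bottom>\<^bsub>A\<^esub> \<and> b = \<bottom>\<^bsub>B\<^esub> \<or> a = \<top>\<^bsub>A\<^esub> \<and> b = \<top>\<^bsub>B\<^esub>"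
  using inl_eq_inr_iff by metis

lemmas emb_eq_iffs = inl_eq_iff inr_eq_iff inl_eq_inr_iff inr_eq_inl_iff

lemma carrier_hsum: "carrier H = f ` carrier A \<union> g ` carrier B"
  by (auto simp: hsum_def quotient_def hsum_inl_def hsum_inr_def)

lemma emb_closed [simp]:
  "a \<in> carrier A \<Longrightarrow> f a \<in> carrier H" "b \<in> carrier B \<Longrightarrow> g b \<in> carrier H"
  by (auto simp: carrier_hsum)

lemma hsum_cases [consumes 1, case_names inl inr]:
  assumes "x \<in> carrier H"
  obtains a where "a \<in> carrier A" "x = f a" | b where "b \<in> carrier B" "x = g b"
  using assms by (auto simp: carrier_hsum)

lemma eq_hsum [simp]: "(.=\<^bsub>H\<^esub>) = (=)"
  by (simp add: hsum_def)

lemma le_hsum: "X \<sqsubseteq>\<^bsub>H\<^esub> Y \<longleftrightarrow>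
    (\<exists>a\<in>carrier A. \<exists>a'\<in>carrier A. X = f a \<and> Y = f a' \<and> a \<sqsubseteq>\<^bsub>A\<^esub> a') \<or>
    (\<exists>b\<in>carrier B. \<exists>b'\<in>carrier B. X = g b \<and> Y = g b' \<and> b \<sqsubseteq>\<^bsub>B\<^esub> b')"
  by (simp add: hsum_def)

lemma bound_le_iffs:
  "a \<in> carrier A \<Longrightarrow> \<bottom>\<^bsub>A\<^esub> \<sqsubseteq>\<^bsub>A\<^esub> a" "a \<in> carrier A \<Longrightarrow> a \<sqsubseteq>\<^bsub>A\<^esub> \<top>\<^bsub>A\<^esub>"
  "b \<in> carrier B \<Longrightarrow> \<bottom>\<^bsub>B\<^esub> \<sqsubseteq>\<^bsub>B\<^esub> b" "b \<in> carrier B \<Longrightarrow> b \<sqsubseteq>\<^bsub>B\<^esub> \<top>\<^bsub>B\<^esub>"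
  "a \<in> carrier A \<Longrightarrow> a \<sqsubseteq>\<^bsub>A\<^esub> \<bottom>\<^bsub>A\<^esub> \<longleftrightarrow> a = \<bottom>\<^bsub>A\<^esub>" "a \<in> carrier A \<Longrightarrow> \<top>\<^bsub>A\<^esub> \<sqsubseteq>\<^bsub>A\<^esub> a \<longleftrightarrow> a = \<top>\<^bsub>A\<^esub>"
  "b \<in> carrier B \<Longrightarrow> b \<sqsubseteq>\<^bsub>B\<^esub> \<bottom>\<^bsub>B\<^esub> \<longleftrightarrow> b = \<bottom>\<^bsub>B\<^esub>" "b \<in> carrier B \<Longrightarrow> \<top>\<^bsub>B\<^esub> \<sqsubseteq>\<^bsub>B\<^esub> b \<longleftrightarrow> b = \<top>\<^bsub>B\<^esub>"
  using A.bottom_lower A.top_higher B.bottom_lower B.top_higher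
    A.le_antisym B.le_antisym bounds_closed by blast+

lemma le_hsum_iffs:
  "\<lbrakk>a \<in> carrier A; a' \<in> carrier A\<rbrakk> \<Longrightarrow> f a \<sqsubseteq>\<^bsub>H\<^esub> f a' \<longleftrightarrow> a \<sqsubseteq>\<^bsub>A\<^esub> a'"
  "\<lbrakk>b \<in> carrier B; b' \<in> carrier B\<rbrakk> \<Longrightarrow> g b \<sqsubseteq>\<^bsub>H\<^esub> g b' \<longleftrightarrow> b \<sqsubseteq>\<^bsub>B\<^esub> b'"
  "\<lbrakk>a \<in> carrier A; b \<in> carrier B\<rbrakk> \<Longrightarrow> f a \<sqsubseteq>\<^bsub>H\<^esub> g b \<longleftrightarrow> a = \<bottom>\<^bsub>A\<^esub> \<or> b = \<top>\<^bsub>B\<^esub>"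
  "\<lbrakk>a \<in> carrier A; b \<in> carrier B\<rbrakk> \<Longrightarrow> g b \<sqsubseteq>\<^bsub>H\<^esub> f a \<longleftrightarrow> b = \<bottom>\<^bsub>B\<^esub> \<or> a = \<top>\<^bsub>A\<^esub>"
  unfolding le_hsum using A_nontrivial B_nontrivial
  by (auto simp: emb_eq_iffs bound_le_iffs)

lemma partial_order_hsum: "partial_order H"
proof
  fix x y z assume "x \<in> carrier H" "y \<in> carrier H" "z \<in> carrier H" "x \<sqsubseteq>\<^bsub>H\<^esub> y" "y \<sqsubseteq>\<^bsub>H\<^esub> z"
  then show "x \<sqsubseteq>\<^bsub>H\<^esub> z"
    using A_nontrivial B_nontrivial
    by (elim hsum_cases) (auto simp: le_hsum_iffs bound_le_iffs intro: A.le_trans B.le_trans)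
next
  fix x assume "x \<in> carrier H"
  then show "x \<sqsubseteq>\<^bsub>H\<^esub> x" by (elim hsum_cases) (auto simp: le_hsum_iffs)
next
  fix x y assume "x \<in> carrier H" "y \<in> carrier H" "x \<sqsubseteq>\<^bsub>H\<^esub> y" "y \<sqsubseteq>\<^bsub>H\<^esub> x"
  then show "x .=\<^bsub>H\<^esub> y"
    using A_nontrivial B_nontrivial
    by (elim hsum_cases) (auto simp: le_hsum_iffs emb_eq_iffs intro: A.le_antisym B.le_antisym)
qed auto

lemma least_UpperI:
  assumes "s \<in> carrier H" "x \<in> carrier H" "y \<in> carrier H" "x \<sqsubseteq>\<^bsub>H\<^esub> s" "y \<sqsubseteq>\<^bsub>H\<^esub> s"
    "\<And>u. \<lbrakk>u \<in> carrier H; x \<sqsubseteq>\<^bsub>H\<^esub> u; y \<sqsubseteq>\<^bsub>H\<^esub> u\<rbrakk> \<Longrightarrow> s \<sqsubseteq>\<^bsub>H\<^esub> u"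
  shows "least H s (Upper H {x, y})"
  using assms by (auto simp: least_def Upper_def)

lemma greatest_LowerI:
  assumes "s \<in> carrier H" "x \<in> carrier H" "y \<in> carrier H" "s \<sqsubseteq>\<^bsub>H\<^esub> x" "s \<sqsubseteq>\<^bsub>H\<^esub> y"
    "\<And>u. \<lbrakk>u \<in> carrier H; u \<sqsubseteq>\<^bsub>H\<^esub> x; u \<sqsubseteq>\<^bsub>H\<^esub> y\<rbrakk> \<Longrightarrow> u \<sqsubseteq>\<^bsub>H\<^esub> s"
  shows "greatest H s (Lower H {x, y})"
  using assms by (auto simp: greatest_def Lower_def)

lemma join_bottom_A: "a \<in> carrier A \<Longrightarrow> \<bottom>\<^bsub>A\<^esub> \<squnion>\<^bsub>A\<^esub> a = a" "a \<in> carrier A \<Longrightarrow> a \<squnion>\<^bsub>A\<^esub> \<bottom>\<^bsub>A\<^esub> = a"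
  by (meson A.le_antisym A.join_left A.join_right A.join_closed A.join_le A.le_refl
      bounds_closed bound_le_iffs)+

lemma join_bottom_B: "a \<in> carrier B \<Longrightarrow> \<bottom>\<^bsub>B\<^esub> \<squnion>\<^bsub>B\<^esub> a = a" "a \<in> carrier B \<Longrightarrow> a \<squnion>\<^bsub>B\<^esub> \<bottom>\<^bsub>B\<^esub> = a"
  by (meson B.le_antisym B.join_left B.join_right B.join_closed B.join_le B.le_refl
      bounds_closed bound_le_iffs)+

lemma meet_top_A: "a \<in> carrier A \<Longrightarrow> \<top>\<^bsub>A\<^esub> \<sqinter>\<^bsub>A\<^esub> a = a" "a \<in> carrier A \<Longrightarrow> a \<sqinter>\<^bsub>A\<^esub> \<top>\<^bsub>A\<^esub> = a"
  by (meson A.le_antisym A.meet_left A.meet_right A.meet_closed A.meet_le A.le_refl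
      bounds_closed bound_le_iffs)+

lemma meet_top_B: "a \<in> carrier B \<Longrightarrow> \<top>\<^bsub>B\<^esub> \<sqinter>\<^bsub>B\<^esub> a = a" "a \<in> carrier B \<Longrightarrow> a \<sqinter>\<^bsub>B\<^esub> \<top>\<^bsub>B\<^esub> = a"
  by (meson B.le_antisym B.meet_left B.meet_right B.meet_closed B.meet_le B.le_refl
      bounds_closed bound_le_iffs)+

lemma least_inl:
  assumes "a \<in> carrier A" "a' \<in> carrier A"
  shows "least H (f (a \<squnion>\<^bsub>A\<^esub> a')) (Upper H {f a, f a'})"
  by (rule least_UpperI, use assms in \<open>auto simp: le_hsum_iffs A.join_left A.join_right elim!: hsum_cases\<close>)
     (auto simp: le_hsum_iffs A.join_le join_bottom_A)

lemma least_inr: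
  assumes "a \<in> carrier B" "a' \<in> carrier B"
  shows "least H (g (a \<squnion>\<^bsub>B\<^esub> a')) (Upper H {g a, g a'})"
  by (rule least_UpperI, use assms in \<open>auto simp: le_hsum_iffs B.join_left B.join_right elim!: hsum_cases\<close>)
     (auto simp: le_hsum_iffs B.join_le join_bottom_B)

lemma greatest_inl:
  assumes "a \<in> carrier A" "a' \<in> carrier A"
  shows "greatest H (f (a \<sqinter>\<^bsub>A\<^esub> a')) (Lower H {f a, f a'})"
  by (rule greatest_LowerI, use assms in \<open>auto simp: le_hsum_iffs A.meet_left A.meet_right elim!: hsum_cases\<close>)
     (auto simp: le_hsum_iffs A.meet_le meet_top_A)

lemma greatest_inr:
  assumes "a \<in> carrier B" "a' \<in> carrier B"
  shows "greatest H (g (a \<sqinter>\<^bsub>B\<^esub> a')) (Lower H {g a, g a'})"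
  by (rule greatest_LowerI, use assms in \<open>auto simp: le_hsum_iffs B.meet_left B.meet_right elim!: hsum_cases\<close>)
     (auto simp: le_hsum_iffs B.meet_le meet_top_B)

lemma emb_bounds: "g \<bottom>\<^bsub>B\<^esub> = f \<bottom>\<^bsub>A\<^esub>" "g \<top>\<^bsub>B\<^esub> = f \<top>\<^bsub>A\<^esub>"
  by (auto simp: emb_eq_iffs)

lemma least_mixed:
  assumes "a \<in> carrier A - {\<bottom>\<^bsub>A\<^esub>, \<top>\<^bsub>A\<^esub>}" "b \<in> carrier B - {\<bottom>\<^bsub>B\<^esub>, \<top>\<^bsub>B\<^esub>}"
  shows "least H (f \<top>\<^bsub>A\<^esub>) (Upper H {f a, g b})"
  by (rule least_UpperI, use assms in \<open>auto simp: le_hsum_iffs bound_le_iffs elim!: hsum_cases\<close>)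

lemma greatest_mixed:
  assumes "a \<in> carrier A - {\<bottom>\<^bsub>A\<^esub>, \<top>\<^bsub>A\<^esub>}" "b \<in> carrier B - {\<bottom>\<^bsub>B\<^esub>, \<top>\<^bsub>B\<^esub>}"
  shows "greatest H (f \<bottom>\<^bsub>A\<^esub>) (Lower H {f a, g b})"
  by (rule greatest_LowerI, use assms in \<open>auto simp: le_hsum_iffs bound_le_iffs elim!: hsum_cases\<close>)

lemma sup_inf_exist:
  assumes "x \<in> carrier H" "y \<in> carrier H"
  shows "(\<exists>s. least H s (Upper H {x, y})) \<and> (\<exists>s. greatest H s (Lower H {x, y}))"
proof -
  have mixed: "(\<exists>s. least H s (Upper H {f a, g b})) \<and> (\<exists>s. greatest H s (Lower H {f a, g b}))"
    if ab: "a \<in> carrier A" "b \<in> carrier B" for a b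
  proof (cases "a \<in> {\<bottom>\<^bsub>A\<^esub>, \<top>\<^bsub>A\<^esub>}")
    case True
    then have "f a = g \<bottom>\<^bsub>B\<^esub> \<or> f a = g \<top>\<^bsub>B\<^esub>" by (auto simp: emb_bounds)
    then obtain b' where "b' \<in> carrier B" "f a = g b'" using bounds_closed(3,4) by blast
    then show ?thesis using least_inr[of b' b] greatest_inr[of b' b] ab by auto
  next
    case a: False
    show ?thesis
    proof (cases "b \<in> {\<bottom>\<^bsub>B\<^esub>, \<top>\<^bsub>B\<^esub>}")
      case True
      then have "g b = f \<bottom>\<^bsub>A\<^esub> \<or> g b = f \<top>\<^bsub>A\<^esub>" by (auto simp: emb_bounds)
      then obtain a' where "a' \<in> carrier A" "g b = f a'" using bounds_closed(1,2) by blast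
      then show ?thesis using least_inl[of a a'] greatest_inl[of a a'] ab by auto
    next
      case False
      then show ?thesis using a ab least_mixed greatest_mixed by blast
    qed
  qed
  show ?thesis
    using assms(1)
  proof (cases rule: hsum_cases)
    case (inl a)
    show ?thesis using assms(2)
      by (cases rule: hsum_cases) (use inl mixed least_inl greatest_inl in blast)+
  next
    case (inr b)
    show ?thesis using assms(2)
    proof (cases rule: hsum_cases)
      case (inl a)
      then show ?thesis using mixed[of a b] inr by (simp add: insert_commute)
    next
      case (inr b')
      then show ?thesis using \<open>x = g b\<close> \<open>b \<in> carrier B\<close> least_inr greatest_inr by blast
    qed
  qed
qed

lemma bounded_lattice_hsum: "bounded_lattice H"
proof -
  interpret H: partial_order H by (rule partial_order_hsum)
  have "least H (f \<bottom>\<^bsub>A\<^esub>) (carrier H)" "greatest H (f \<top>\<^bsub>A\<^esub>) (carrier H)"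
    unfolding least_def greatest_def by (auto simp: le_hsum_iffs bound_le_iffs elim!: hsum_cases)
  then show ?thesis
    by unfold_locales (use sup_inf_exist in blast)+
qed

sublocale H: bounded_lattice "A \<boxplus> B"
  by (rule bounded_lattice_hsum)

lemma bottom_hsum: "\<bottom>\<^bsub>H\<^esub> = f \<bottom>\<^bsub>A\<^esub>"
  by (rule H.bottom_eq[symmetric]) (auto simp: le_hsum_iffs bound_le_iffs elim!: hsum_cases)

lemma top_hsum: "\<top>\<^bsub>H\<^esub> = f \<top>\<^bsub>A\<^esub>"
  by (rule H.top_eq[symmetric]) (auto simp: le_hsum_iffs bound_le_iffs elim!: hsum_cases)

lemma inl_Int_inr: "f ` carrier A \<inter> g ` carrier B = {\<bottom>\<^bsub>H\<^esub>, \<top>\<^bsub>H\<^esub>}"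
proof -
  have "{f \<bottom>\<^bsub>A\<^esub>, f \<top>\<^bsub>A\<^esub>} \<subseteq> g ` carrier B"
    by (metis bounds_closed(3,4) emb_bounds empty_subsetI image_eqI insert_subset)
  then show ?thesis
    by (auto simp: bottom_hsum top_hsum emb_eq_iffs)
qed

lemma join_unique: "\<lbrakk>least H s (Upper H {x, y}); x \<in> carrier H; y \<in> carrier H\<rbrakk> \<Longrightarrow> x \<squnion>\<^bsub>H\<^esub> y = s"
  by (rule H.joinI, erule (1) H.least_unique)

lemma meet_unique: "\<lbrakk>greatest H s (Lower H {x, y}); x \<in> carrier H; y \<in> carrier H\<rbrakk> \<Longrightarrow> x \<sqinter>\<^bsub>H\<^esub> y = s"
  by (rule H.meetI, erule (1) H.greatest_unique)

lemma join_hsum: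
  "\<lbrakk>a \<in> carrier A; a' \<in> carrier A\<rbrakk> \<Longrightarrow> f a \<squnion>\<^bsub>H\<^esub> f a' = f (a \<squnion>\<^bsub>A\<^esub> a')"
  "\<lbrakk>b \<in> carrier B; b' \<in> carrier B\<rbrakk> \<Longrightarrow> g b \<squnion>\<^bsub>H\<^esub> g b' = g (b \<squnion>\<^bsub>B\<^esub> b')"
  "\<lbrakk>a \<in> carrier A - {\<bottom>\<^bsub>A\<^esub>, \<top>\<^bsub>A\<^esub>}; b \<in> carrier B - {\<bottom>\<^bsub>B\<^esub>, \<top>\<^bsub>B\<^esub>}\<rbrakk> \<Longrightarrow> f a \<squnion>\<^bsub>H\<^esub> g b = \<top>\<^bsub>H\<^esub>"
  subgoal by (rule join_unique[OF least_inl]) simp_all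
  subgoal by (rule join_unique[OF least_inr]) simp_all
  subgoal unfolding top_hsum by (rule join_unique[OF least_mixed]) simp_all
  done

lemma meet_hsum:
  "\<lbrakk>a \<in> carrier A; a' \<in> carrier A\<rbrakk> \<Longrightarrow> f a \<sqinter>\<^bsub>H\<^esub> f a' = f (a \<sqinter>\<^bsub>A\<^esub> a')"
  "\<lbrakk>b \<in> carrier B; b' \<in> carrier B\<rbrakk> \<Longrightarrow> g b \<sqinter>\<^bsub>H\<^esub> g b' = g (b \<sqinter>\<^bsub>B\<^esub> b')"
  "\<lbrakk>a \<in> carrier A - {\<bottom>\<^bsub>A\<^esub>, \<top>\<^bsub>A\<^esub>}; b \<in> carrier B - {\<bottom>\<^bsub>B\<^esub>, \<top>\<^bsub>B\<^esub>}\<rbrakk> \<Longrightarrow> f a \<sqinter>\<^bsub>H\<^esub> g b = \<bottom>\<^bsub>H\<^esub>"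
  subgoal by (rule meet_unique[OF greatest_inl]) simp_all
  subgoal by (rule meet_unique[OF greatest_inr]) simp_all
  subgoal unfolding bottom_hsum by (rule meet_unique[OF greatest_mixed]) simp_all
  done

end

end

theory Submission
  imports Defs
begin

text \<open>
  Everything rests on two observations. A subset of a bounded lattice that contains the top and
  not the bottom is a prime filter iff its complement is a prime ideal, iff the partition into the
  two sets is a congruence: all three say that the set is the preimage of the top under a
  homomorphism onto the two-element chain. That chain is simple, so such a congruence is
  automatically maximal. In the horizontal sum, \<open>A - {0}\<close> and \<open>B - {1}\<close> are complementary, hence
  (ii) to (v) are equivalent without any further look at the sum.

  What is particular to the sum is that non-bounds of different summands are complements of each
  other. A prime filter contains exactly one of two complementary elements. So once it contains
  one non-bound of \<open>A\<close>, it misses all non-bounds of \<open>B\<close> and therefore contains all those of \<open>A\<close>.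
  Finally, \<open>A - {0}\<close> is closed under meets iff 0 is meet-irreducible in \<open>A\<close>,
  and it is prime iff its complement \<open>B - {1}\<close> is closed under joins, which means that
  1 is join-irreducible in \<open>B\<close>.
\<close>

section \<open>Prime filters as two-class congruences\<close>

context bounded_lattice
begin

lemma filter_top: "lattice_filter L F \<Longrightarrow> \<top> \<in> F"
  unfolding lattice_filter_def using top_higher by blast

lemma filter_proper_iff: "lattice_filter L F \<Longrightarrow> F \<noteq> carrier L \<longleftrightarrow> \<bottom> \<notin> F"
  unfolding lattice_filter_def using bottom_lower bottom_closed by blast

lemma ideal_bottom: "lattice_ideal L I \<Longrightarrow> \<bottom> \<in> I"
  unfolding lattice_ideal_def using bottom_lower by blast

lemma ideal_proper_iff: "lattice_ideal L I \<Longrightarrow> I \<noteq> carrier L \<longleftrightarrow> \<top> \<notin> I"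
  unfolding lattice_ideal_def using top_higher by blast

text \<open>
  The right-hand side says that the characteristic function of \<open>F\<close> is a bound-preserving
  lattice homomorphism to the two-element chain. Upward closure is not listed because
  \<open>x \<sqsubseteq> y\<close> means \<open>x \<squnion> y = y\<close>. Without the order, the description turns into the one
  of prime ideals below on passing to complements.
\<close>

lemma prime_filter_iff_hom:
  "F \<in> Spec_Filt L \<longleftrightarrow> F \<subseteq> carrier L \<and> \<top> \<in> F \<and> \<bottom> \<notin> F \<and>
     (\<forall>x\<in>carrier L. \<forall>y\<in>carrier L.
        (x \<sqinter> y \<in> F \<longleftrightarrow> x \<in> F \<and> y \<in> F) \<and> (x \<squnion> y \<in> F \<longleftrightarrow> x \<in> F \<or> y \<in> F))"
  (is "_ \<longleftrightarrow> ?hom")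
proof
  assume F: "F \<in> Spec_Filt L"
  then have flt: "lattice_filter L F" and "F \<noteq> carrier L" by (auto simp: Spec_Filt_def)
  then have "\<top> \<in> F" "\<bottom> \<notin> F" using filter_top filter_proper_iff by auto
  have up: "y \<in> F" if "x \<in> F" "y \<in> carrier L" "x \<sqsubseteq> y" for x y
    using flt that by (auto simp: lattice_filter_def)
  show ?hom
  proof (intro conjI ballI)
    fix x y assume xy: "x \<in> carrier L" "y \<in> carrier L"
    show "x \<sqinter> y \<in> F \<longleftrightarrow> x \<in> F \<and> y \<in> F"
      using flt up[of "x \<sqinter> y"] meet_left[OF xy] meet_right[OF xy] xy
      by (auto simp: lattice_filter_def)
    show "x \<squnion> y \<in> F \<longleftrightarrow> x \<in> F \<or> y \<in> F"
      using F up[of _ "x \<squnion> y"] join_left[OF xy] join_right[OF xy] join_closed[OF xy] xy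
      unfolding Spec_Filt_def by blast
  qed (use flt \<open>\<top> \<in> F\<close> \<open>\<bottom> \<notin> F\<close> in \<open>auto simp: lattice_filter_def\<close>)
next
  assume hom: ?hom
  have up: "y \<in> F" if "x \<in> F" "y \<in> carrier L" "x \<sqsubseteq> y" for x y
  proof -
    have x: "x \<in> carrier L" using hom that(1) by blast
    then have "x \<squnion> y = y" using that by (simp flip: le_iff_meet)
    then show ?thesis using hom x that by metis
  qed
  have "lattice_filter L F"
    unfolding lattice_filter_def
  proof (intro conjI ballI impI)
    fix x y assume "x \<in> F" "y \<in> F"
    moreover from this have "x \<in> carrier L" "y \<in> carrier L" using hom by blast+
    ultimately show "x \<sqinter> y \<in> F" using hom by simp
  qed (use hom in blast, use hom in blast, rule up)
  moreover have "F \<noteq> carrier L" using hom by force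
  ultimately show "F \<in> Spec_Filt L"
    using hom by (simp add: Spec_Filt_def)
qed

lemma prime_ideal_iff_hom:
  "I \<in> Spec_Id L \<longleftrightarrow> I \<subseteq> carrier L \<and> \<bottom> \<in> I \<and> \<top> \<notin> I \<and>
     (\<forall>x\<in>carrier L. \<forall>y\<in>carrier L.
        (x \<squnion> y \<in> I \<longleftrightarrow> x \<in> I \<and> y \<in> I) \<and> (x \<sqinter> y \<in> I \<longleftrightarrow> x \<in> I \<or> y \<in> I))"
  (is "_ \<longleftrightarrow> ?hom")
proof
  assume I: "I \<in> Spec_Id L"
  then have idl: "lattice_ideal L I" and "I \<noteq> carrier L" by (auto simp: Spec_Id_def)
  then have "\<bottom> \<in> I" "\<top> \<notin> I" using ideal_bottom ideal_proper_iff by auto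
  have down: "y \<in> I" if "x \<in> I" "y \<in> carrier L" "y \<sqsubseteq> x" for x y
    using idl that by (auto simp: lattice_ideal_def)
  show ?hom
  proof (intro conjI ballI)
    fix x y assume xy: "x \<in> carrier L" "y \<in> carrier L"
    show "x \<squnion> y \<in> I \<longleftrightarrow> x \<in> I \<and> y \<in> I"
      using idl down[of "x \<squnion> y"] join_left[OF xy] join_right[OF xy] xy
      by (auto simp: lattice_ideal_def)
    show "x \<sqinter> y \<in> I \<longleftrightarrow> x \<in> I \<or> y \<in> I"
      using I down[of _ "x \<sqinter> y"] meet_left[OF xy] meet_right[OF xy] meet_closed[OF xy] xy
      unfolding Spec_Id_def by blast
  qed (use idl \<open>\<bottom> \<in> I\<close> \<open>\<top> \<notin> I\<close> in \<open>auto simp: lattice_ideal_def\<close>)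
next
  assume hom: ?hom
  have down: "y \<in> I" if "x \<in> I" "y \<in> carrier L" "y \<sqsubseteq> x" for x y
  proof -
    have x: "x \<in> carrier L" using hom that(1) by blast
    then have "y = y \<sqinter> x" using that by (simp flip: le_iff_join)
    then show ?thesis using hom x that by metis
  qed
  have "lattice_ideal L I"
    unfolding lattice_ideal_def
  proof (intro conjI ballI impI)
    fix x y assume "x \<in> I" "y \<in> I"
    moreover from this have "x \<in> carrier L" "y \<in> carrier L" using hom by blast+
    ultimately show "x \<squnion> y \<in> I" using hom by simp
  qed (use hom in blast, use hom in blast, rule down)
  moreover have "I \<noteq> carrier L" using hom by force
  ultimately show "I \<in> Spec_Id L"
    using hom by (simp add: Spec_Id_def)
qed

lemma prime_filter_iff_prime_ideal_compl:
  assumes "F \<subseteq> carrier L"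
  shows "F \<in> Spec_Filt L \<longleftrightarrow> carrier L - F \<in> Spec_Id L"
proof -
  have "(x \<sqinter> y \<in> F \<longleftrightarrow> x \<in> F \<and> y \<in> F) \<and> (x \<squnion> y \<in> F \<longleftrightarrow> x \<in> F \<or> y \<in> F) \<longleftrightarrow>
      (x \<squnion> y \<in> carrier L - F \<longleftrightarrow> x \<in> carrier L - F \<and> y \<in> carrier L - F) \<and>
      (x \<sqinter> y \<in> carrier L - F \<longleftrightarrow> x \<in> carrier L - F \<or> y \<in> carrier L - F)"
    if "x \<in> carrier L" "y \<in> carrier L" for x y
    using that by auto
  then show ?thesis
    using assms unfolding prime_filter_iff_hom prime_ideal_iff_hom
    by (simp add: conj_left_commute cong: ball_cong)
qed

lemma prime_ideal_iff_prime_filter_compl: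
  "I \<subseteq> carrier L \<Longrightarrow> I \<in> Spec_Id L \<longleftrightarrow> carrier L - I \<in> Spec_Filt L"
  using prime_filter_iff_prime_ideal_compl[of "carrier L - I"] by (simp add: double_diff)

lemma mem_eq_of_compl:
  "F \<subseteq> carrier L \<Longrightarrow> (x, y) \<in> eq_of {F, carrier L - F} \<longleftrightarrow>
     x \<in> carrier L \<and> y \<in> carrier L \<and> (x \<in> F \<longleftrightarrow> y \<in> F)"
  by (auto simp: eq_of_def)

lemma equiv_eq_of_compl: "F \<subseteq> carrier L \<Longrightarrow> equiv (carrier L) (eq_of {F, carrier L - F})"
  by (auto intro!: equivI simp: refl_on_def sym_def trans_def eq_of_def)

text \<open>
  In the direction from congruences to filters, \<open>F\<close> and its complement are the classes of
  the top and of the bottom; replacing elements by these bounds inside a join or a meet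
  determines its class.
\<close>

lemma two_class_congruence_iff_prime_filter:
  assumes F: "F \<subseteq> carrier L" "\<top> \<in> F" "\<bottom> \<notin> F"
  shows "eq_of {F, carrier L - F} \<in> Con L \<longleftrightarrow> F \<in> Spec_Filt L"
    (is "?\<theta> \<in> _ \<longleftrightarrow> _")
proof
  note mem = mem_eq_of_compl[OF F(1)]
  assume con: "?\<theta> \<in> Con L"
  have join: "x \<squnion> y \<in> F \<longleftrightarrow> x' \<squnion> y' \<in> F" and meet: "x \<sqinter> y \<in> F \<longleftrightarrow> x' \<sqinter> y' \<in> F"
    if "(x, x') \<in> ?\<theta>" "(y, y') \<in> ?\<theta>" for x x' y y'
  proof -
    have "(x \<squnion> y, x' \<squnion> y') \<in> ?\<theta>" "(x \<sqinter> y, x' \<sqinter> y') \<in> ?\<theta>"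
      using con that unfolding Con_def by fast+
    then show "x \<squnion> y \<in> F \<longleftrightarrow> x' \<squnion> y' \<in> F" "x \<sqinter> y \<in> F \<longleftrightarrow> x' \<sqinter> y' \<in> F"
      by (simp_all add: mem)
  qed
  have cls: "(x, if x \<in> F then \<top> else \<bottom>) \<in> ?\<theta>" if "x \<in> carrier L" for x
    using that F by (simp add: mem)
  show "F \<in> Spec_Filt L"
    unfolding prime_filter_iff_hom
  proof (intro conjI ballI)
    fix x y assume xy: "x \<in> carrier L" "y \<in> carrier L"
    note absorb = bottom_meet bottom_join top_meet top_join
    have bounds:
      "\<top> \<squnion> \<top> = \<top>" "\<bottom> \<squnion> \<top> = \<top>" "\<bottom> \<squnion> \<bottom> = \<bottom>" "\<top> \<squnion> \<bottom> = \<top>"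
      "\<top> \<sqinter> \<top> = \<top>" "\<bottom> \<sqinter> \<top> = \<bottom>" "\<bottom> \<sqinter> \<bottom> = \<bottom>" "\<top> \<sqinter> \<bottom> = \<bottom>"
      using absorb[OF top_closed] absorb[OF bottom_closed] by (simp_all add: eq_is_equal)
    show "x \<sqinter> y \<in> F \<longleftrightarrow> x \<in> F \<and> y \<in> F"
      using meet[OF cls[OF xy(1)] cls[OF xy(2)]] F by (auto simp: bounds split: if_splits)
    show "x \<squnion> y \<in> F \<longleftrightarrow> x \<in> F \<or> y \<in> F"
      using join[OF cls[OF xy(1)] cls[OF xy(2)]] F by (auto simp: bounds split: if_splits)
  qed (use F in auto)
next
  assume "F \<in> Spec_Filt L"
  then have "(x \<squnion> y, x' \<squnion> y') \<in> ?\<theta> \<and> (x \<sqinter> y, x' \<sqinter> y') \<in> ?\<theta>"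
    if "(x, x') \<in> ?\<theta>" "(y, y') \<in> ?\<theta>" for x x' y y'
    using that by (simp add: mem_eq_of_compl[OF F(1)] prime_filter_iff_hom)
  then show "?\<theta> \<in> Con L"
    unfolding Con_def using equiv_eq_of_compl[OF F(1)] by fast
qed

text \<open>
  A larger equivalence relates some element of one class to one of the other, which
  merges the only two classes.
\<close>

lemma two_class_congruence_maximal:
  assumes F: "F \<subseteq> carrier L" "F \<noteq> {}" "F \<noteq> carrier L"
    and con: "eq_of {F, carrier L - F} \<in> Con L"
  shows "eq_of {F, carrier L - F} \<in> Max_Con L"
    (is "?\<theta> \<in> _")
proof -
  note mem = mem_eq_of_compl[OF F(1)]
  have "\<psi> = carrier L \<times> carrier L" if \<psi>: "\<psi> \<in> Con L" "?\<theta> \<subset> \<psi>" for \<psi>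
  proof -
    have eqv: "equiv (carrier L) \<psi>" using \<psi> by (simp add: Con_def)
    have sub: "\<psi> \<subseteq> carrier L \<times> carrier L" using eqv by (rule equiv_type)
    have symD: "(y, x) \<in> \<psi>" if "(x, y) \<in> \<psi>" for x y
      using eqv that by (elim equivE) (rule Relation.symD)
    have transD: "(x, z) \<in> \<psi>" if "(x, y) \<in> \<psi>" "(y, z) \<in> \<psi>" for x y z
      using eqv that by (elim equivE) (rule Relation.transD)
    obtain x y where "(x, y) \<in> \<psi>" "(x, y) \<notin> ?\<theta>" using \<psi>(2) by auto
    then obtain u v where uv: "u \<in> F" "v \<in> carrier L" "v \<notin> F" "(u, v) \<in> \<psi>"
      using sub mem symD by blast
    have "(z, u) \<in> \<psi>" if "z \<in> carrier L" for z
    proof (cases "z \<in> F")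
      case True
      then have "(z, u) \<in> ?\<theta>" using uv F(1) by (auto simp: mem)
      then show ?thesis using \<psi>(2) by auto
    next
      case False
      then have "(z, v) \<in> ?\<theta>" using uv that by (auto simp: mem)
      then show ?thesis using \<psi>(2) transD symD uv(4) by blast
    qed
    then show ?thesis using sub transD symD by blast
  qed
  moreover have "?\<theta> \<noteq> carrier L \<times> carrier L"
    using F mem by blast
  ultimately show ?thesis using con by (simp add: Max_Con_def)
qed

section \<open>Prime filters and complementary sets of elements\<close>

text \<open>
  The join of \<open>p\<close> and \<open>q\<close> is the top, so by primality \<open>F\<close> contains one of them. Their meet is
  the bottom, so it does not contain both. Hence any single \<open>q\<close> outside \<open>F\<close> forces
  all of \<open>P\<close> into \<open>F\<close>, and vice versa.
\<close>

lemma prime_filter_of_complementary_sets: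
  assumes F: "F \<in> Spec_Filt L"
    and car: "carrier L = P \<union> Q \<union> {\<bottom>, \<top>}" and ne: "P \<noteq> {}" "Q \<noteq> {}"
    and compl: "\<And>p q. \<lbrakk>p \<in> P; q \<in> Q\<rbrakk> \<Longrightarrow> p \<squnion> q = \<top> \<and> p \<sqinter> q = \<bottom>"
  shows "F = P \<union> {\<top>} \<or> F = Q \<union> {\<top>}"
proof -
  have F': "F \<subseteq> carrier L" "\<top> \<in> F" "\<bottom> \<notin> F"
    using F by (auto simp: prime_filter_iff_hom)
  have one: "p \<in> F \<longleftrightarrow> q \<notin> F" if "p \<in> P" "q \<in> Q" for p q
  proof -
    have "p \<in> carrier L" "q \<in> carrier L" using that car by auto
    then show ?thesis
      using F F'(2,3) compl[OF that] unfolding prime_filter_iff_hom by metis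
  qed
  obtain p q where "p \<in> P" "q \<in> Q" using ne by auto
  show ?thesis
  proof (cases "p \<in> F")
    case True
    then have "P \<subseteq> F" "Q \<inter> F = {}" using one \<open>p \<in> P\<close> \<open>q \<in> Q\<close> by blast+
    then show ?thesis using F' car by blast
  next
    case False
    then have "Q \<subseteq> F" "P \<inter> F = {}" using one \<open>p \<in> P\<close> \<open>q \<in> Q\<close> by blast+
    then show ?thesis using F' car by blast
  qed
qed

end

lemma more_than_two_elementsE:
  assumes "infinite S \<or> card S > 2"
  obtains x where "x \<in> S" "x \<noteq> u" "x \<noteq> v"
proof -
  have "\<not> S \<subseteq> {u, v}"
  proof
    assume S: "S \<subseteq> {u, v}"
    then have "finite S" "card S \<le> card {u, v}"
      by (auto intro: finite_subset card_mono)
    moreover have "card {u, v} \<le> 2" by (simp add: card_insert_if)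
    ultimately show False using assms by simp
  qed
  then show ?thesis using that by blast
qed

section \<open>The horizontal sum\<close>

context hsum_summands
begin

lemma emb_eq_bounds:
  "a \<in> carrier A \<Longrightarrow> f a = \<bottom>\<^bsub>H\<^esub> \<longleftrightarrow> a = \<bottom>\<^bsub>A\<^esub>" "a \<in> carrier A \<Longrightarrow> f a = \<top>\<^bsub>H\<^esub> \<longleftrightarrow> a = \<top>\<^bsub>A\<^esub>"
  "b \<in> carrier B \<Longrightarrow> g b = \<bottom>\<^bsub>H\<^esub> \<longleftrightarrow> b = \<bottom>\<^bsub>B\<^esub>" "b \<in> carrier B \<Longrightarrow> g b = \<top>\<^bsub>H\<^esub> \<longleftrightarrow> b = \<top>\<^bsub>B\<^esub>"
  using A_nontrivial B_nontrivial by (auto simp: bottom_hsum top_hsum emb_eq_iffs)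

lemma bottom_neq_top_hsum: "\<bottom>\<^bsub>H\<^esub> \<noteq> \<top>\<^bsub>H\<^esub>"
  using A_nontrivial by (simp add: bottom_hsum emb_eq_bounds)

lemma bounds_mem_emb:
  "\<bottom>\<^bsub>H\<^esub> \<in> f ` carrier A" "\<top>\<^bsub>H\<^esub> \<in> f ` carrier A"
  "\<bottom>\<^bsub>H\<^esub> \<in> g ` carrier B" "\<top>\<^bsub>H\<^esub> \<in> g ` carrier B"
  using inl_Int_inr by blast+

text \<open>
  The elements of the sum are equivalence classes, hence sets. The set algebra is therefore
  carried out for variables \<open>u\<close> and \<open>v\<close>, so that automation does not
  compare the two bounds by extensionality.
\<close>

lemma compl_inl: "carrier H - (f ` carrier A - {\<bottom>\<^bsub>H\<^esub>}) = g ` carrier B - {\<top>\<^bsub>H\<^esub>}"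
proof -
  have "(S \<union> T) - (S - {u}) = T - {v}" if "S \<inter> T = {u, v}" "u \<noteq> v"
    for S T :: "('a + 'b) set set" and u v
    using that by blast
  then show ?thesis
    using inl_Int_inr bottom_neq_top_hsum unfolding carrier_hsum by simp
qed

lemma compl_inr: "carrier H - (g ` carrier B - {\<bottom>\<^bsub>H\<^esub>}) = f ` carrier A - {\<top>\<^bsub>H\<^esub>}"
proof -
  have "(S \<union> T) - (T - {u}) = S - {v}" if "S \<inter> T = {u, v}" "u \<noteq> v"
    for S T :: "('a + 'b) set set" and u v
    using that by blast
  then show ?thesis
    using inl_Int_inr bottom_neq_top_hsum unfolding carrier_hsum by simp
qed

lemma Spec_Filt_hsum_subset:
  assumes "carrier A \<noteq> {\<bottom>\<^bsub>A\<^esub>, \<top>\<^bsub>A\<^esub>}" "carrier B \<noteq> {\<bottom>\<^bsub>B\<^esub>, \<top>\<^bsub>B\<^esub>}"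
  shows "Spec_Filt H \<subseteq> {f ` carrier A - {\<bottom>\<^bsub>H\<^esub>}, g ` carrier B - {\<bottom>\<^bsub>H\<^esub>}}"
proof
  fix F assume F: "F \<in> Spec_Filt H"
  define P where "P = f ` carrier A - {\<bottom>\<^bsub>H\<^esub>, \<top>\<^bsub>H\<^esub>}"
  define Q where "Q = g ` carrier B - {\<bottom>\<^bsub>H\<^esub>, \<top>\<^bsub>H\<^esub>}"
  have "F = P \<union> {\<top>\<^bsub>H\<^esub>} \<or> F = Q \<union> {\<top>\<^bsub>H\<^esub>}"
  proof (rule H.prime_filter_of_complementary_sets[OF F])
    show "carrier H = P \<union> Q \<union> {\<bottom>\<^bsub>H\<^esub>, \<top>\<^bsub>H\<^esub>}"
      using bounds_mem_emb unfolding P_def Q_def carrier_hsum by blast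
    obtain a where "a \<in> carrier A" "a \<noteq> \<bottom>\<^bsub>A\<^esub>" "a \<noteq> \<top>\<^bsub>A\<^esub>"
      using assms(1) bounds_closed by blast
    then have "f a \<in> P" by (simp add: P_def emb_eq_bounds)
    then show "P \<noteq> {}" by blast
    obtain b where "b \<in> carrier B" "b \<noteq> \<bottom>\<^bsub>B\<^esub>" "b \<noteq> \<top>\<^bsub>B\<^esub>"
      using assms(2) bounds_closed by blast
    then have "g b \<in> Q" by (simp add: Q_def emb_eq_bounds)
    then show "Q \<noteq> {}" by blast
    show "p \<squnion>\<^bsub>H\<^esub> q = \<top>\<^bsub>H\<^esub> \<and> p \<sqinter>\<^bsub>H\<^esub> q = \<bottom>\<^bsub>H\<^esub>" if pq: "p \<in> P" "q \<in> Q" for p q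
    proof -
      obtain a b where "a \<in> carrier A" "p = f a" "b \<in> carrier B" "q = g b"
        using pq unfolding P_def Q_def by blast
      then show ?thesis
        using pq by (simp add: P_def Q_def emb_eq_bounds join_hsum meet_hsum)
    qed
  qed
  moreover have "S - {u, v} \<union> {v} = S - {u}" if "v \<in> S" "u \<noteq> v"
    for S :: "('a + 'b) set set" and u v
    using that by blast
  ultimately show "F \<in> {f ` carrier A - {\<bottom>\<^bsub>H\<^esub>}, g ` carrier B - {\<bottom>\<^bsub>H\<^esub>}}"
    using bounds_mem_emb bottom_neq_top_hsum unfolding P_def Q_def by simp
qed

lemma Spec_Id_hsum_subset:
  assumes "carrier A \<noteq> {\<bottom>\<^bsub>A\<^esub>, \<top>\<^bsub>A\<^esub>}" "carrier B \<noteq> {\<bottom>\<^bsub>B\<^esub>, \<top>\<^bsub>B\<^esub>}"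
  shows "Spec_Id H \<subseteq> {f ` carrier A - {\<top>\<^bsub>H\<^esub>}, g ` carrier B - {\<top>\<^bsub>H\<^esub>}}"
proof
  fix I assume I: "I \<in> Spec_Id H"
  then have sub: "I \<subseteq> carrier H" by (simp add: H.prime_ideal_iff_hom)
  then have "carrier H - I \<in> Spec_Filt H"
    using I by (simp add: H.prime_ideal_iff_prime_filter_compl)
  then have "carrier H - I = f ` carrier A - {\<bottom>\<^bsub>H\<^esub>} \<or> carrier H - I = g ` carrier B - {\<bottom>\<^bsub>H\<^esub>}"
    using Spec_Filt_hsum_subset[OF assms] by blast
  then have "I = g ` carrier B - {\<top>\<^bsub>H\<^esub>} \<or> I = f ` carrier A - {\<top>\<^bsub>H\<^esub>}"
    using double_diff[OF sub subset_refl] compl_inl compl_inr by metis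
  then show "I \<in> {f ` carrier A - {\<top>\<^bsub>H\<^esub>}, g ` carrier B - {\<top>\<^bsub>H\<^esub>}}" by auto
qed

text \<open>
  Meets in \<open>A - {0}\<close> are computed in \<open>A\<close>, and primality concerns joins of elements
  outside \<open>A - {0}\<close>, that is, joins computed in \<open>B - {1}\<close>. So each of the two
  irreducibility conditions accounts for one of the two closure properties.
\<close>

lemma inl_prime_filter_iff:
  "f ` carrier A - {\<bottom>\<^bsub>H\<^esub>} \<in> Spec_Filt H \<longleftrightarrow>
     bottom_meet_irreducible A \<and> top_join_irreducible B"
    (is "?F \<in> _ \<longleftrightarrow> _")
proof
  assume F: "?F \<in> Spec_Filt H"
  have "bottom_meet_irreducible A"
    unfolding bottom_meet_irreducible_def
  proof (intro ballI impI)
    fix x y assume xy: "x \<in> carrier A" "y \<in> carrier A" "x \<sqinter>\<^bsub>A\<^esub> y = \<bottom>\<^bsub>A\<^esub>"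
    then have "f x \<sqinter>\<^bsub>H\<^esub> f y \<notin> ?F" by (simp add: meet_hsum bottom_hsum)
    then have "f x \<notin> ?F \<or> f y \<notin> ?F"
      using F xy unfolding H.prime_filter_iff_hom by (metis emb_closed(1))
    then show "x = \<bottom>\<^bsub>A\<^esub> \<or> y = \<bottom>\<^bsub>A\<^esub>" using xy by (simp add: emb_eq_bounds)
  qed
  moreover have "top_join_irreducible B"
    unfolding top_join_irreducible_def
  proof (intro ballI impI)
    fix x y assume xy: "x \<in> carrier B" "y \<in> carrier B" "x \<squnion>\<^bsub>B\<^esub> y = \<top>\<^bsub>B\<^esub>"
    then have "g x \<squnion>\<^bsub>H\<^esub> g y = \<top>\<^bsub>H\<^esub>" by (simp add: join_hsum emb_eq_bounds)
    then have "g x \<in> ?F \<or> g y \<in> ?F"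
      using F xy unfolding H.prime_filter_iff_hom by (metis emb_closed(2))
    then have "g x \<notin> g ` carrier B - {\<top>\<^bsub>H\<^esub>} \<or> g y \<notin> g ` carrier B - {\<top>\<^bsub>H\<^esub>}"
      unfolding compl_inl[symmetric] by blast
    then show "x = \<top>\<^bsub>B\<^esub> \<or> y = \<top>\<^bsub>B\<^esub>" using xy by (simp add: emb_eq_bounds)
  qed
  ultimately show "bottom_meet_irreducible A \<and> top_join_irreducible B" ..
next
  assume irr: "bottom_meet_irreducible A \<and> top_join_irreducible B"
  have up: "y \<in> ?F" if xy: "x \<in> ?F" "y \<in> carrier H" "x \<sqsubseteq>\<^bsub>H\<^esub> y" for x y
    using xy(2)
  proof (cases rule: hsum_cases)
    case (inl a)
    obtain a' where "a' \<in> carrier A" "x = f a'" "x \<noteq> \<bottom>\<^bsub>H\<^esub>" using xy(1) by blast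
    then have "a \<noteq> \<bottom>\<^bsub>A\<^esub>"
      using xy(3) inl bound_le_iffs(5) by (metis emb_eq_bounds(1) le_hsum_iffs(1))
    then show ?thesis using inl by (simp add: emb_eq_bounds)
  next
    case (inr b)
    obtain a' where "a' \<in> carrier A" "x = f a'" "x \<noteq> \<bottom>\<^bsub>H\<^esub>" using xy(1) by blast
    then have "y = \<top>\<^bsub>H\<^esub>"
      using xy(3) inr by (metis emb_eq_bounds(1,4) le_hsum_iffs(3))
    then show ?thesis using bounds_mem_emb bottom_neq_top_hsum by simp
  qed
  have meet: "x \<sqinter>\<^bsub>H\<^esub> y \<in> ?F" if xy: "x \<in> ?F" "y \<in> ?F" for x y
  proof -
    obtain a a' where "a \<in> carrier A" "x = f a" "a' \<in> carrier A" "y = f a'"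
      using xy by blast
    then show ?thesis
      using xy irr by (simp add: meet_hsum emb_eq_bounds) (metis bottom_meet_irreducible_def)
  qed
  have prime: "x \<in> ?F \<or> y \<in> ?F"
    if xy: "x \<in> carrier H" "y \<in> carrier H" "x \<squnion>\<^bsub>H\<^esub> y \<in> ?F" for x y
  proof (rule ccontr)
    assume "\<not> ?thesis"
    then have "x \<in> g ` carrier B - {\<top>\<^bsub>H\<^esub>}" "y \<in> g ` carrier B - {\<top>\<^bsub>H\<^esub>}"
      using xy unfolding compl_inl[symmetric] by blast+
    moreover from this obtain b b' where "b \<in> carrier B" "x = g b" "b' \<in> carrier B" "y = g b'"
      by blast
    ultimately have "x \<squnion>\<^bsub>H\<^esub> y \<in> g ` carrier B - {\<top>\<^bsub>H\<^esub>}"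
      using irr by (simp add: join_hsum emb_eq_bounds) (metis top_join_irreducible_def)
    then show False using xy(3) unfolding compl_inl[symmetric] by blast
  qed
  have "\<top>\<^bsub>H\<^esub> \<in> ?F" using bounds_mem_emb bottom_neq_top_hsum by simp
  then have ne: "?F \<noteq> {}" by blast
  have sub: "?F \<subseteq> carrier H" unfolding carrier_hsum by blast
  have "lattice_filter H ?F"
    unfolding lattice_filter_def using sub ne meet up by (intro conjI ballI impI)
  moreover have "?F \<noteq> carrier H" using H.bottom_closed by blast
  ultimately show "?F \<in> Spec_Filt H"
    unfolding Spec_Filt_def using prime by (intro CollectI conjI ballI impI)
qed

end

theorem proposition4p4:
  fixes A :: "('a, 'm) gorder_scheme" and B :: "('b, 'n) gorder_scheme"
  assumes "bounded_lattice A" and "bounded_lattice B"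
    and "infinite (carrier A) \<or> card (carrier A) > 2"
    and "infinite (carrier B) \<or> card (carrier B) > 2"
  shows
    "let H = A \<boxplus> B; A' = hsum_inl A B ` carrier A; B' = hsum_inr A B ` carrier B in
       Spec_Filt H \<subseteq> {A' - {\<bottom>\<^bsub>H\<^esub>}, B' - {\<bottom>\<^bsub>H\<^esub>}} \<and>
       Spec_Id H \<subseteq> {A' - {\<top>\<^bsub>H\<^esub>}, B' - {\<top>\<^bsub>H\<^esub>}} \<and>
       (bottom_meet_irreducible A \<and> top_join_irreducible B \<longleftrightarrow>
          A' - {\<bottom>\<^bsub>H\<^esub>} \<in> Spec_Filt H) \<and>
       (A' - {\<bottom>\<^bsub>H\<^esub>} \<in> Spec_Filt H \<longleftrightarrow> B' - {\<top>\<^bsub>H\<^esub>} \<in> Spec_Id H) \<and>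
       (B' - {\<top>\<^bsub>H\<^esub>} \<in> Spec_Id H \<longleftrightarrow> eq_of {A' - {\<bottom>\<^bsub>H\<^esub>}, B' - {\<top>\<^bsub>H\<^esub>}} \<in> Con H) \<and>
       (eq_of {A' - {\<bottom>\<^bsub>H\<^esub>}, B' - {\<top>\<^bsub>H\<^esub>}} \<in> Con H \<longleftrightarrow>
          eq_of {A' - {\<bottom>\<^bsub>H\<^esub>}, B' - {\<top>\<^bsub>H\<^esub>}} \<in> Max_Con H)"
proof -
  interpret A: bounded_lattice A by fact
  interpret B: bounded_lattice B by fact
  obtain a where a: "a \<in> carrier A" "a \<noteq> \<bottom>\<^bsub>A\<^esub>" "a \<noteq> \<top>\<^bsub>A\<^esub>"
    using assms(3) by (rule more_than_two_elementsE)
  obtain b where b: "b \<in> carrier B" "b \<noteq> \<bottom>\<^bsub>B\<^esub>" "b \<noteq> \<top>\<^bsub>B\<^esub>"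
    using assms(4) by (rule more_than_two_elementsE)
  \<comment> \<open>If the bounds coincided, the lattice would have only one element.\<close>
  interpret hsum_summands A B
  proof
    show "\<bottom>\<^bsub>A\<^esub> \<noteq> \<top>\<^bsub>A\<^esub>"
      using a by (metis A.bottom_lower A.top_higher A.le_antisym A.top_closed)
    show "\<bottom>\<^bsub>B\<^esub> \<noteq> \<top>\<^bsub>B\<^esub>"
      using b by (metis B.bottom_lower B.top_higher B.le_antisym B.top_closed)
  qed
  have nontriv: "carrier A \<noteq> {\<bottom>\<^bsub>A\<^esub>, \<top>\<^bsub>A\<^esub>}" "carrier B \<noteq> {\<bottom>\<^bsub>B\<^esub>, \<top>\<^bsub>B\<^esub>}"
    using a b by auto
  let ?F = "f ` carrier A - {\<bottom>\<^bsub>H\<^esub>}" and ?I = "g ` carrier B - {\<top>\<^bsub>H\<^esub>}"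
  have F: "?F \<subseteq> carrier H" "\<top>\<^bsub>H\<^esub> \<in> ?F" "\<bottom>\<^bsub>H\<^esub> \<notin> ?F"
    using carrier_hsum bounds_mem_emb bottom_neq_top_hsum by auto
  have filter_ideal: "?F \<in> Spec_Filt H \<longleftrightarrow> ?I \<in> Spec_Id H"
    using H.prime_filter_iff_prime_ideal_compl[OF F(1)] by (simp add: compl_inl)
  have filter_con: "?F \<in> Spec_Filt H \<longleftrightarrow> eq_of {?F, ?I} \<in> Con H"
    using H.two_class_congruence_iff_prime_filter[OF F] by (simp add: compl_inl)
  have "?F \<noteq> {}" "?F \<noteq> carrier H" using F by auto
  then have con_max: "eq_of {?F, ?I} \<in> Con H \<longleftrightarrow> eq_of {?F, ?I} \<in> Max_Con H"
    using H.two_class_congruence_maximal[OF F(1)] unfolding compl_inl by (auto simp: Max_Con_def)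
  show ?thesis
    unfolding Let_def
    using Spec_Filt_hsum_subset[OF nontriv] Spec_Id_hsum_subset[OF nontriv]
      inl_prime_filter_iff filter_ideal filter_con con_max
    by simp
qed

end
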